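(* Let $k$ be an admissible kernel that is nonincreasing in the first variable. Define $w(t):=\|k(\cdot,t)\|_{L^1}$, $t\in(0,\infty)$, and suppose that $C:=\operatorname{ess\,sup}_{t\in(0,\infty)}\|k(\cdot,t)\|_{L^\infty}\in(0,\infty)$. Denote $b(t):=w^*(t)/C$, $t\in(0,\infty)$, and define $$c:=\operatorname{ess\,inf}_{t\in(0,\infty)}\frac1{b(t)}\int_0^{b(t)}k(s,t)\,ds.$$ If $c\in(0,\infty)$, then every $f\in\mathcal M(0,\infty)$ satisfies $$\frac c2\int_0^{b(t)}f^*(s)\,ds\le\int_0^\infty f^*(s)k(s,t)\,ds\quad\text{for a.e. }t\in(0,\infty).$$
   Context: $\mathcal M(0,\infty)$ denotes the set of Lebesgue measurable $f\colon(0,\infty)\to[-\infty,\infty]$; $\lambda$ is Lebesgue measure, $L^p=L^p(0,\infty)$. Convention: $0\cdot\infty=0$. The nonincreasing rearrangement of $f\in\mathcal M(0,\infty)$ is $f^*(x):=\inf\{t\in[0,\infty):\lambda(\{y\in(0,\infty):|f(y)|>t\})\le x\}$, $x\in[0,\infty)$. An admissible kernel is a measurable function $k\colon(0,\infty)\times(0,\infty)\to[0,\infty]$ such that $k(\cdot,t)$ is integrable on $(0,\infty)$ for a.e. $t\in(0,\infty)$. *)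

theory Defs
  imports "HOL-Analysis.Analysis" "HOL-Probability.Essential_Supremum"
begin

abbreviation half_line :: "real measure" where
  "half_line \<equiv> lebesgue_on {0<..}"

(* On ennreal the conventions are 0 * top = 0, 1 / 0 = top and 1 / top = 0; Inf {} = top. *)

definition rearrangement :: "(real \<Rightarrow> ereal) \<Rightarrow> real \<Rightarrow> ennreal" where
  "rearrangement f x =
     Inf {ennreal t | t::real. 0 \<le> t \<and>
            emeasure half_line {y \<in> space half_line. \<bar>f y\<bar> > ereal t} \<le> ennreal x}"

(* Integral of a nonnegative function over (0,b), where b may be infinite. *)
definition integral_upto :: "ennreal \<Rightarrow> (real \<Rightarrow> ennreal) \<Rightarrow> ennreal" where
  "integral_upto b g = (\<integral>\<^sup>+ s\<in>{s. ennreal s < b}. g s \<partial>half_line)"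

(* Counterpart of the library's esssup, which has no essential infimum. *)
definition essinf :: "'a measure \<Rightarrow> ('a \<Rightarrow> ennreal) \<Rightarrow> ennreal" where
  "essinf M g = Sup {z. AE x in M. z \<le> g x}"

(* Measurability is with respect to the Lebesgue (not just Borel) sets of the plane; only the
   values of k on (0,\<infinity>) x (0,\<infinity>) matter. *)
definition admissible_kernel :: "(real \<Rightarrow> real \<Rightarrow> ennreal) \<Rightarrow> bool" where
  "admissible_kernel k \<longleftrightarrow>
     (\<lambda>(s, t). k s t) \<in> borel_measurable (lebesgue_on ({0<..} \<times> {0<..})) \<and>
     (AE t in half_line. (\<lambda>s. k s t) \<in> borel_measurable half_line \<and>
                         (\<integral>\<^sup>+ s. k s t \<partial>half_line) < \<infinity>)"

end

theory Submission
  imports Defs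
begin

text \<open>
  At almost every \<open>t\<close>, both \<open>f\<^sup>*\<close> and \<open>k(\<cdot>,t)\<close> are nonincreasing, so Chebyshev's integral
  inequality on \<open>(0, b(t))\<close> bounds the product of their integrals by \<open>b(t)\<close> times the integral of
  their product, and the mean of \<open>k(\<cdot>,t)\<close> over \<open>(0, b(t))\<close> is essentially bounded below by \<open>c\<close>.
  The factor \<open>1/2\<close> only serves to pick a bound below the essential infimum.
\<close>

text \<open>With \<open>b = a + u\<close> and \<open>d = c + v\<close> the two sides differ by
  exactly \<open>u * v\<close>. Arguing by addition rather than by the sign of (b - a)(d - c) covers
  infinite values too.\<close>

lemma rearrangement_ineq_ennreal:
  fixes a b c d :: ennreal
  assumes "a \<le> b \<and> c \<le> d \<or> b \<le> a \<and> d \<le> c"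
  shows "a * d + b * c \<le> a * c + b * d"
proof -
  have *: "a * d + b * c \<le> a * c + b * d" if le: "a \<le> b" "c \<le> d" for a b c d :: ennreal
  proof -
    obtain u v where "b = a + u" "d = c + v"
      using le by (auto simp: le_iff_add)
    then have "a * c + b * d = (a * d + b * c) + u * v"
      by (simp add: algebra_simps)
    then show ?thesis by simp
  qed
  show ?thesis
    using assms *[of a b c d] *[of b a d c] by (auto simp: add.commute)
qed

text \<open>The two-point inequality is integrated in \<open>y\<close> and then in \<open>x\<close>.
  Each term is a product of a function of \<open>x\<close> and one of \<open>y\<close>, so the
  iterated integrals factor without Fubini and \<open>M\<close> may be any measure.\<close>

lemma nn_integral_Chebyshev:
  fixes f g :: "'a \<Rightarrow> ennreal"
  assumes [measurable]: "f \<in> borel_measurable M" "g \<in> borel_measurable M"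
    and comonotone: "\<And>x y. x \<in> space M \<Longrightarrow> y \<in> space M \<Longrightarrow>
          f x \<le> f y \<and> g x \<le> g y \<or> f y \<le> f x \<and> g y \<le> g x"
  shows "(\<integral>\<^sup>+x. f x \<partial>M) * (\<integral>\<^sup>+x. g x \<partial>M) \<le> emeasure M (space M) * (\<integral>\<^sup>+x. f x * g x \<partial>M)"
    (is "?F * ?G \<le> ?m * ?FG")
proof -
  have "2 * (?F * ?G) = (\<integral>\<^sup>+x. \<integral>\<^sup>+y. f x * g y + f y * g x \<partial>M \<partial>M)"
    by (simp add: nn_integral_add nn_integral_cmult nn_integral_multc mult_2 mult.commute)
  also have "\<dots> \<le> (\<integral>\<^sup>+x. \<integral>\<^sup>+y. f x * g x + f y * g y \<partial>M \<partial>M)"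
    by (intro nn_integral_mono rearrangement_ineq_ennreal comonotone)
  also have "\<dots> = 2 * (?m * ?FG)"
    by (simp add: nn_integral_add nn_integral_cmult nn_integral_multc mult_2 mult.commute)
  finally show ?thesis
    by (simp add: ennreal_mult_le_mult_iff)
qed

text \<open>Only an inequality, since the quotient is 0 for \<open>a = 0\<close> and
  \<open>a = top\<close>. It lets the final estimate cancel \<open>b t\<close> without excluding
  these values.\<close>

lemma divide_self_le_1: "a / a \<le> (1::ennreal)"
  by (cases "a = 0 \<or> a = top") (auto simp: less_top)

lemma antimono_rearrangement: "antimono (rearrangement f)"
  unfolding rearrangement_def
  by (intro antimonoI Inf_superset_mono) (blast intro: order_trans ennreal_leI)

lemma borel_measurable_antimono:
  fixes f :: "real \<Rightarrow> 'b::{second_countable_topology, linorder_topology}"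
  assumes "antimono f"
  shows "f \<in> borel_measurable borel"
proof (rule borel_measurableI_greater)
  fix y
  have "is_interval {x. y < f x}"
    unfolding is_interval_1 using assms by (auto dest: antimonoD intro: less_le_trans)
  then show "{x \<in> space borel. y < f x} \<in> sets borel"
    using real_interval_borel_measurable by simp
qed

text \<open>Turns the truncation into a measure of its own, to which Chebyshev's inequality
  applies.\<close>

lemma integral_upto_restrict_space:
  "integral_upto b g = (\<integral>\<^sup>+ s. g s \<partial>restrict_space half_line {s. ennreal s < b})"
proof -
  have "{0<..} \<inter> {s. ennreal s < b} \<in> sets lebesgue"
    by (intro sets.Int) (auto intro!: sets_completionI_sets)
  then show ?thesis
    unfolding integral_upto_def
    by (subst nn_integral_restrict_space) (auto simp: space_restrict_space sets_restrict_space_iff)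
qed

lemma emeasure_restrict_upto_le:
  "emeasure (restrict_space half_line {s. ennreal s < b})
     (space (restrict_space half_line {s. ennreal s < b})) \<le> b"
proof (cases b)
  case (real r)
  then have "{0<..} \<inter> {s. ennreal s < b} = {0<..<r}"
    by (auto simp: ennreal_less_iff)
  with real show ?thesis
    by (simp add: restrict_restrict_space space_restrict_space emeasure_restrict_space)
qed simp

theorem proposition5p5:
  fixes k :: "real \<Rightarrow> real \<Rightarrow> ennreal"
    and w b :: "real \<Rightarrow> ennreal"
    and C c :: ennreal
  assumes k: "admissible_kernel k"
    and k_nonincreasing: "\<And>t. t > 0 \<Longrightarrow> antimono_on {0<..} (\<lambda>s. k s t)"
    and w: "\<And>t. t > 0 \<Longrightarrow> w t = (\<integral>\<^sup>+ s. k s t \<partial>half_line)"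
    and C: "C = esssup half_line (\<lambda>t. esssup half_line (\<lambda>s. k s t))"
    and C_range: "0 < C" "C < \<infinity>"
    and b: "\<And>t. t > 0 \<Longrightarrow> b t = rearrangement (\<lambda>u. enn2ereal (w u)) t / C"
    and c: "c = essinf half_line (\<lambda>t. 1 / b t * integral_upto (b t) (\<lambda>s. k s t))"
    and c_range: "0 < c" "c < \<infinity>"
  shows "\<forall>f \<in> borel_measurable half_line.
           AE t in half_line.
             c / 2 * integral_upto (b t) (rearrangement f)
               \<le> (\<integral>\<^sup>+ s. rearrangement f s * k s t \<partial>half_line)"
proof
  fix f :: "real \<Rightarrow> ereal"
  have "c / 2 < c"
    using c_range by (cases c) (auto simp: ennreal_divide_numeral ennreal_less_iff)
  \<comment> \<open>As \<open>c\<close> is the supremum of the a.e. lower bounds, some such bound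
    exceeds \<open>c / 2\<close>; whether the supremum is attained does not matter.\<close>
  then obtain z where z: "c / 2 < z"
      "AE t in half_line. z \<le> 1 / b t * integral_upto (b t) (\<lambda>s. k s t)"
    using c unfolding essinf_def by (auto simp: less_Sup_iff)
  have "AE t in half_line. (\<lambda>s. k s t) \<in> borel_measurable half_line"
    using k by (auto simp: admissible_kernel_def)
  moreover have "AE t in half_line. 0 < t"
    by (rule AE_I2) (simp add: space_restrict_space)
  ultimately show "AE t in half_line. c / 2 * integral_upto (b t) (rearrangement f)
               \<le> (\<integral>\<^sup>+ s. rearrangement f s * k s t \<partial>half_line)"
    using z(2)
  proof eventually_elim
    case (elim t)
    define M where "M = restrict_space half_line {s. ennreal s < b t}"
    have [measurable]: "(\<lambda>s. k s t) \<in> borel_measurable M"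
      unfolding M_def by (intro measurable_restrict_space1 elim)
    \<comment> \<open>Since \<open>ennreal x\<close> is 0 for negative \<open>x\<close>,
      \<open>rearrangement f\<close> is nonincreasing on the whole line, hence Borel.\<close>
    have "rearrangement f \<in> borel_measurable lebesgue"
      using borel_measurable_antimono[OF antimono_rearrangement]
      by (intro measurable_completion) simp
    then have [measurable]: "rearrangement f \<in> borel_measurable M"
      unfolding M_def by (intro measurable_restrict_space1)
    have "(\<integral>\<^sup>+s. rearrangement f s \<partial>M) * (\<integral>\<^sup>+s. k s t \<partial>M)
            \<le> emeasure M (space M) * (\<integral>\<^sup>+s. rearrangement f s * k s t \<partial>M)"
    proof (rule nn_integral_Chebyshev)
      fix x y
      assume "x \<in> space M" "y \<in> space M"
      then have "x \<in> {0<..}" "y \<in> {0<..}"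
        by (auto simp: M_def space_restrict_space)
      then show "rearrangement f x \<le> rearrangement f y \<and> k x t \<le> k y t \<or>
                 rearrangement f y \<le> rearrangement f x \<and> k y t \<le> k x t"
        \<comment> \<open>Whichever of \<open>x\<close> and \<open>y\<close> is larger, both
          functions take their smaller value there.\<close>
        using monotone_onD[OF k_nonincreasing[OF \<open>0 < t\<close>]] antimonoD[OF antimono_rearrangement[of f]]
        by (metis linear)
    qed simp_all
    then have Chebyshev: "integral_upto (b t) (rearrangement f) * integral_upto (b t) (\<lambda>s. k s t)
        \<le> b t * integral_upto (b t) (\<lambda>s. rearrangement f s * k s t)"
      unfolding integral_upto_restrict_space M_def
      by (rule order_trans) (intro mult_right_mono emeasure_restrict_upto_le zero_le)
    have "c / 2 * integral_upto (b t) (rearrangement f)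
        \<le> 1 / b t * integral_upto (b t) (\<lambda>s. k s t) * integral_upto (b t) (rearrangement f)"
      using z(1) elim by (intro mult_right_mono) auto
    also have "\<dots> = 1 / b t * (integral_upto (b t) (rearrangement f) * integral_upto (b t) (\<lambda>s. k s t))"
      by (simp add: ac_simps)
    also have "\<dots> \<le> 1 / b t * (b t * integral_upto (b t) (\<lambda>s. rearrangement f s * k s t))"
      by (intro mult_left_mono Chebyshev) simp
    also have "\<dots> = (b t / b t) * integral_upto (b t) (\<lambda>s. rearrangement f s * k s t)"
      by (simp add: ennreal_times_divide mult.assoc[symmetric] mult.commute[of _ "b t"])
    also have "\<dots> \<le> 1 * integral_upto (b t) (\<lambda>s. rearrangement f s * k s t)"
      by (intro mult_right_mono divide_self_le_1) simp
    also have "\<dots> \<le> (\<integral>\<^sup>+ s. rearrangement f s * k s t \<partial>half_line)"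
      unfolding integral_upto_def
      by (auto intro!: nn_integral_mono simp: indicator_def)
    finally show ?case .
  qed
qed

end
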